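(* There exist universal constants $c,C\in(0,\infty)$ such that for every $n\in\mathbb{N}$, $$c\sqrt{n}\le c_1\big(\ell_2^n(\mathbb{F}_2^n)\big)\le C\sqrt{n}.$$
   Context: $\mathbb{N}=\{1,2,3,\ldots\}$ and $\mathbb{F}_2$ is the field with two elements. $\mathbb{F}_2^n$ is equipped with the Hamming metric, i.e. the metric $\|x-y\|_1$ inherited from $\ell_1^n$ when $\mathbb{F}_2^n$ is identified with $\{0,1\}^n\subset\mathbb{R}^n$. For a metric space $(X,d_X)$, $\ell_2^n(X)$ is the set $X^n$ with the metric $d_{\ell_2^n(X)}\big((x_1,\ldots,x_n),(y_1,\ldots,y_n)\big)=\sqrt{d_X(x_1,y_1)^2+\cdots+d_X(x_n,y_n)^2}$. Thus $\ell_2^n(\mathbb{F}_2^n)$ is the set $\prod_{j=1}^n\mathbb{F}_2^n$ with metric $\big(\sum_{j=1}^n\|x_j-y_j\|_1^2\big)^{1/2}$. $L_1$ denotes $L_1(0,1)$ (real-valued functions, Lebesgue measure). For a metric space $(X,d_X)$, $c_1(X)$ is the infimum over those $D\in[1,\infty)$ for which there exist $s\in(0,\infty)$ and $f:X\to L_1$ with $s\,d_X(x,y)\le\|f(x)-f(y)\|_1\le D s\,d_X(x,y)$ for all $x,y\in X$ (with $c_1(X)=\infty$ if no such $D$ exists). *)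

theory Defs
  imports "HOL-Analysis.Analysis" "HOL-Library.Z2"
begin

text \<open>
  Points of \<open>X\<^sup>n\<close> are functions on the index set \<open>{1..n}\<close>, extended by
  \<^const>\<open>undefined\<close> outside it, so that equality in the carrier is equality of tuples.
\<close>

definition F2_cube :: "nat \<Rightarrow> (nat \<Rightarrow> bit) metric" where
  "F2_cube n = metric (({1..n} \<rightarrow>\<^sub>E (UNIV :: bit set)),
     (\<lambda>x y. \<Sum>i = 1..n. \<bar>of_bit (x i) - of_bit (y i) :: real\<bar>))"

definition l2_power :: "nat \<Rightarrow> 'a metric \<Rightarrow> (nat \<Rightarrow> 'a) metric" where
  "l2_power n X = metric (({1..n} \<rightarrow>\<^sub>E mspace X),
     (\<lambda>x y. sqrt (\<Sum>j = 1..n. (mdist X (x j) (y j))\<^sup>2)))"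

text \<open>
  The abstract type \<open>metric\<close> leaves \<open>metric (M, d)\<close> unspecified unless \<open>d\<close> is a metric on \<open>M\<close>;
  the following lemmas show that the two definitions above denote the intended spaces.
\<close>

lemma Metric_space_F2_cube:
  fixes n :: nat
  shows "Metric_space ({1..n} \<rightarrow>\<^sub>E (UNIV :: bit set))
     (\<lambda>x y. \<Sum>i = 1..n. \<bar>of_bit (x i) - of_bit (y i) :: real\<bar>)"
proof
  fix x y z :: "nat \<Rightarrow> bit"
  show "0 \<le> (\<Sum>i = 1..n. \<bar>of_bit (x i) - of_bit (y i) :: real\<bar>)"
    by (simp add: sum_nonneg)
  show "(\<Sum>i = 1..n. \<bar>of_bit (x i) - of_bit (y i) :: real\<bar>) =
      (\<Sum>i = 1..n. \<bar>of_bit (y i) - of_bit (x i) :: real\<bar>)"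
    by (simp add: abs_minus_commute)
  show "(\<Sum>i = 1..n. \<bar>of_bit (x i) - of_bit (z i) :: real\<bar>) \<le>
      (\<Sum>i = 1..n. \<bar>of_bit (x i) - of_bit (y i) :: real\<bar>) +
      (\<Sum>i = 1..n. \<bar>of_bit (y i) - of_bit (z i) :: real\<bar>)"
    unfolding sum.distrib [symmetric] by (rule sum_mono) linarith
  assume xy: "x \<in> {1..n} \<rightarrow>\<^sub>E UNIV" "y \<in> {1..n} \<rightarrow>\<^sub>E UNIV"
  have eq: "of_bit a - of_bit b = (0 :: real) \<longleftrightarrow> a = b" for a b :: bit
    by (cases a; cases b) auto
  have "(\<Sum>i = 1..n. \<bar>of_bit (x i) - of_bit (y i) :: real\<bar>) = 0 \<longleftrightarrow> (\<forall>i\<in>{1..n}. x i = y i)"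
    by (subst sum_nonneg_eq_0_iff) (simp_all only: finite_atLeastAtMost abs_ge_zero abs_eq_0 eq)
  also have "\<dots> \<longleftrightarrow> x = y"
    using xy by (auto intro: PiE_ext)
  finally show "(\<Sum>i = 1..n. \<bar>of_bit (x i) - of_bit (y i) :: real\<bar>) = 0 \<longleftrightarrow> x = y" .
qed

lemma mspace_F2_cube: "mspace (F2_cube n) = {1..n} \<rightarrow>\<^sub>E UNIV"
  unfolding F2_cube_def by (rule Metric_space.mspace_metric [OF Metric_space_F2_cube])

lemma mdist_F2_cube:
  "mdist (F2_cube n) x y = (\<Sum>i = 1..n. \<bar>of_bit (x i) - of_bit (y i) :: real\<bar>)"
  unfolding F2_cube_def by (simp only: Metric_space.mdist_metric [OF Metric_space_F2_cube])

lemma Metric_space_l2_power: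
  fixes n :: nat and X :: "'a metric"
  shows "Metric_space ({1..n} \<rightarrow>\<^sub>E mspace X) (\<lambda>x y. sqrt (\<Sum>j = 1..n. (mdist X (x j) (y j))\<^sup>2))"
proof
  fix x y z :: "nat \<Rightarrow> 'a"
  show "0 \<le> sqrt (\<Sum>j = 1..n. (mdist X (x j) (y j))\<^sup>2)"
    by (simp add: sum_nonneg)
  show "sqrt (\<Sum>j = 1..n. (mdist X (x j) (y j))\<^sup>2) = sqrt (\<Sum>j = 1..n. (mdist X (y j) (x j))\<^sup>2)"
    by (simp add: mdist_commute)
  assume x: "x \<in> {1..n} \<rightarrow>\<^sub>E mspace X" and y: "y \<in> {1..n} \<rightarrow>\<^sub>E mspace X"
  have "sqrt (\<Sum>j = 1..n. (mdist X (x j) (y j))\<^sup>2) = 0 \<longleftrightarrow> (\<forall>j\<in>{1..n}. mdist X (x j) (y j) = 0)"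
    by (subst real_sqrt_eq_0_iff, subst sum_nonneg_eq_0_iff) auto
  also have "\<dots> \<longleftrightarrow> (\<forall>j\<in>{1..n}. x j = y j)"
    using x y by (intro ball_cong refl mdist_zero) (auto simp: PiE_mem)
  also have "\<dots> \<longleftrightarrow> x = y"
    using x y by (auto intro: PiE_ext)
  finally show "sqrt (\<Sum>j = 1..n. (mdist X (x j) (y j))\<^sup>2) = 0 \<longleftrightarrow> x = y" .
  assume z: "z \<in> {1..n} \<rightarrow>\<^sub>E mspace X"
  have "L2_set (\<lambda>j. mdist X (x j) (z j)) {1..n} \<le>
      L2_set (\<lambda>j. mdist X (x j) (y j) + mdist X (y j) (z j)) {1..n}"
    using x y z by (intro L2_set_mono mdist_triangle) (auto simp: PiE_mem)
  also have "\<dots> \<le> L2_set (\<lambda>j. mdist X (x j) (y j)) {1..n} + L2_set (\<lambda>j. mdist X (y j) (z j)) {1..n}"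
    by (rule L2_set_triangle_ineq)
  finally show "sqrt (\<Sum>j = 1..n. (mdist X (x j) (z j))\<^sup>2) \<le>
      sqrt (\<Sum>j = 1..n. (mdist X (x j) (y j))\<^sup>2) + sqrt (\<Sum>j = 1..n. (mdist X (y j) (z j))\<^sup>2)"
    by (simp add: L2_set_def)
qed

lemma mspace_l2_power: "mspace (l2_power n X) = {1..n} \<rightarrow>\<^sub>E mspace X"
  unfolding l2_power_def by (rule Metric_space.mspace_metric [OF Metric_space_l2_power])

lemma mdist_l2_power:
  "mdist (l2_power n X) x y = sqrt (\<Sum>j = 1..n. (mdist X (x j) (y j))\<^sup>2)"
  unfolding l2_power_def by (simp only: Metric_space.mdist_metric [OF Metric_space_l2_power])

text \<open>
  Elements of \<open>L\<^sub>1(0,1)\<close> are given by representatives, i.e. integrable functions that are not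
  identified when they agree almost everywhere. Only the \<open>L\<^sub>1\<close> seminorm of differences is used
  below, so this does not affect which distortions are attained.
\<close>

definition L1_space :: "(real \<Rightarrow> real) set" where
  "L1_space = {g. integrable (lebesgue_on {0<..<1}) g}"

definition L1_norm :: "(real \<Rightarrow> real) \<Rightarrow> real" where
  "L1_norm g = (LINT t|lebesgue_on {0<..<1}. \<bar>g t\<bar>)"

definition embeds_in_L1_with_distortion :: "'a metric \<Rightarrow> real \<Rightarrow> bool" where
  "embeds_in_L1_with_distortion X D \<longleftrightarrow>
     (\<exists>s > 0. \<exists>f \<in> mspace X \<rightarrow> L1_space. \<forall>x \<in> mspace X. \<forall>y \<in> mspace X.
        s * mdist X x y \<le> L1_norm (\<lambda>t. f x t - f y t) \<and>
        L1_norm (\<lambda>t. f x t - f y t) \<le> D * s * mdist X x y)"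

text \<open>The infimum is taken in \<^typ>\<open>ereal\<close>, where \<open>Inf {} = \<infinity>\<close>.\<close>

definition c1 :: "'a metric \<Rightarrow> ereal" where
  "c1 X = Inf {ereal D | D. 1 \<le> D \<and> embeds_in_L1_with_distortion X D}"

end

theory Submission
  imports Defs
begin

text \<open>
  Both bounds compare the Pythagorean sum with the \<open>\<ell>\<^sub>1\<close> sum of the rows. For \<open>n\<close> nonnegative
  numbers the \<open>\<ell>\<^sub>1\<close> and \<open>\<ell>\<^sub>2\<close> norms differ by a factor of at most \<open>\<surd>n\<close>, and the Hamming cube of
  dimension \<open>n\<^sup>2\<close> sits isometrically in \<open>L\<^sub>1\<close>. So replacing the \<open>\<ell>\<^sub>2\<close> sum of the rows by their
  \<open>\<ell>\<^sub>1\<close> sum gives an embedding of distortion \<open>\<surd>n\<close> (\<open>sqrt_distortion_embedding\<close>).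

  The lower bound comes from a metric form of the Kwapien--Schuett inequality, in the manner of
  Naor and Schechtman. For a function \<open>f\<close> from \<open>n \<times> n\<close> bit matrices to \<open>L\<^sub>1\<close>, compare two kinds of
  random displacement. Flipping an entire row moves a matrix by \<open>n\<close>, because the flipped entries
  add up inside one row. Flipping at most one entry in every row moves it by at most \<open>\<surd>n\<close>. The
  inequality says that in \<open>L\<^sub>1\<close> the first average displacement is at most 6 times the second, and
  so the distortion is at least \<open>n / (6 \<surd>n)\<close>.

  To prove the inequality, note that it is linear in the distances. Integrating over the measure
  space reduces it to real-valued functions, and cutting at random thresholds reduces it further
  to indicator functions, for which the absolute difference equals its square. A quadratic
  translation-invariant inequality on a finite Boolean group is diagonalised by the Walsh
  functions, so it is enough to check it on each character \<open>walsh A\<close> (\<open>shift_inequality_L1\<close>).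

  On a character, the row flip of row \<open>j\<close> counts exactly when \<open>A\<close> has an odd number of entries in
  row \<open>j\<close>. If \<open>m\<close> rows are odd, the row flips contribute \<open>2m\<close>. The one-flip-per-row step is a product of
  independent steps in the \<open>n\<close> rows, and so its average on the character is a product over the
  rows. Each odd row contributes a factor of absolute value at most \<open>1 - 2/(n + 1)\<close>, so the
  product is at most \<open>(1 - 2/(n + 1))\<^sup>m\<close>, whose distance from 1 is of order \<open>m/n\<close> since
  \<open>m \<le> n\<close> (\<open>flips_walsh_inequality\<close>).
\<close>

section \<open>Walsh functions on the subsets of a finite set\<close>

text \<open>
  The group \<open>F\<^sub>2\<^sup>I\<close> is represented by the subsets of \<open>I\<close> with symmetric difference as addition;
  \<open>walsh A\<close> is its character indexed by \<open>A\<close>.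
\<close>

definition walsh :: "'a set \<Rightarrow> 'a set \<Rightarrow> real" where
  "walsh A S = (-1) ^ card (A \<inter> S)"

lemma walsh_eq_prod:
  assumes "finite A"
  shows "walsh A S = (\<Prod>i\<in>A. if i \<in> S then -1 else 1)"
  using assms unfolding walsh_def by (simp add: prod.If_cases Int_def)

lemma walsh_sym_diff:
  assumes "finite A"
  shows "walsh A (sym_diff S T) = walsh A S * walsh A T"
  unfolding walsh_eq_prod[OF assms] prod.distrib[symmetric] by (rule prod.cong) auto

text \<open>Summing over all characters expands the product of the factors \<open>1 + walsh {i} S\<close>, each of
  which is 2 or 0.\<close>

lemma sum_walsh:
  assumes "finite I" "S \<subseteq> I"
  shows "(\<Sum>A\<in>Pow I. walsh A S) = (if S = {} then 2 ^ card I else 0)"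
proof -
  have "(\<Sum>A\<in>Pow I. walsh A S) = (\<Sum>A\<in>Pow I. \<Prod>i\<in>A. if i \<in> S then -1 else 1)"
    using assms(1) by (intro sum.cong refl walsh_eq_prod) (auto intro: finite_subset)
  also have "\<dots> = (\<Prod>i\<in>I. (if i \<in> S then -1 else 1) + 1)"
    by (subst prod_add[OF assms(1)]) simp
  also have "\<dots> = (if S = {} then 2 ^ card I else 0)"
    using assms by (auto simp: prod_zero_iff)
  finally show ?thesis .
qed

text \<open>
  Parseval's identity for \<open>f\<close> and its translate by \<open>T\<close>: translation multiplies the Fourier
  coefficient at \<open>A\<close> by the character value \<open>walsh A T\<close>.
\<close>

lemma walsh_autocorrelation:
  assumes "finite I" "T \<subseteq> I"
  shows "(\<Sum>A\<in>Pow I. (\<Sum>S\<in>Pow I. f S * walsh A S)\<^sup>2 * walsh A T)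
    = 2 ^ card I * (\<Sum>S\<in>Pow I. f (sym_diff S T) * f S)"
proof -
  have "(\<Sum>A\<in>Pow I. (\<Sum>S\<in>Pow I. f S * walsh A S)\<^sup>2 * walsh A T)
    = (\<Sum>A\<in>Pow I. \<Sum>S\<in>Pow I. \<Sum>R\<in>Pow I. f S * f R * walsh A (sym_diff (sym_diff S T) R))"
  proof (rule sum.cong[OF refl])
    fix A assume "A \<in> Pow I"
    then have "finite A" using assms(1) finite_subset by auto
    then show "(\<Sum>S\<in>Pow I. f S * walsh A S)\<^sup>2 * walsh A T
        = (\<Sum>S\<in>Pow I. \<Sum>R\<in>Pow I. f S * f R * walsh A (sym_diff (sym_diff S T) R))"
      unfolding power2_eq_square sum_product
      unfolding sum_distrib_right walsh_sym_diff[OF \<open>finite A\<close>]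
      by (intro sum.cong refl) (simp add: mult_ac)
  qed
  also have "\<dots> = (\<Sum>S\<in>Pow I. \<Sum>A\<in>Pow I. \<Sum>R\<in>Pow I. f S * f R * walsh A (sym_diff (sym_diff S T) R))"
    by (rule sum.swap)
  also have "\<dots> = (\<Sum>S\<in>Pow I. \<Sum>R\<in>Pow I. \<Sum>A\<in>Pow I. f S * f R * walsh A (sym_diff (sym_diff S T) R))"
    by (intro sum.cong refl sum.swap)
  also have "\<dots> = (\<Sum>S\<in>Pow I. \<Sum>R\<in>Pow I. if R = sym_diff S T then 2 ^ card I * (f R * f S) else 0)"
  proof (intro sum.cong refl)
    fix S R assume "S \<in> Pow I" "R \<in> Pow I"
    then have sub: "sym_diff (sym_diff S T) R \<subseteq> I" using assms(2) by auto
    have "sym_diff (sym_diff S T) R = {} \<longleftrightarrow> R = sym_diff S T" by auto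
    then show "(\<Sum>A\<in>Pow I. f S * f R * walsh A (sym_diff (sym_diff S T) R))
        = (if R = sym_diff S T then 2 ^ card I * (f R * f S) else 0)"
      unfolding sum_distrib_left[symmetric] sum_walsh[OF assms(1) sub] by simp
  qed
  also have "\<dots> = (\<Sum>S\<in>Pow I. 2 ^ card I * (f (sym_diff S T) * f S))"
  proof (intro sum.cong refl)
    fix S assume "S \<in> Pow I"
    then have "sym_diff S T \<in> Pow I" using assms(2) by auto
    then show "(\<Sum>R\<in>Pow I. if R = sym_diff S T then 2 ^ card I * (f R * f S) else 0)
        = 2 ^ card I * (f (sym_diff S T) * f S)"
      using assms(1) by (subst sum.delta) auto
  qed
  finally show ?thesis by (simp add: sum_distrib_left)
qed

lemma sum_shift:
  assumes "T \<subseteq> I"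
  shows "(\<Sum>S\<in>Pow I. g (sym_diff S T)) = (\<Sum>S\<in>Pow I. g S)"
  by (rule sum.reindex_bij_witness[where i="\<lambda>S. sym_diff S T" and j="\<lambda>S. sym_diff S T"])
     (use assms in \<open>auto intro!: arg_cong[where f=g]\<close>)

text \<open>
  The mean square displacement under a translation is a combination of the numbers
  \<open>1 - walsh A T\<close> with nonnegative weights that do not depend on \<open>T\<close>. This is what allows
  inequalities between such displacements to be tested on characters.
\<close>

lemma sum_shift_diff_squared:
  fixes f :: "'a set \<Rightarrow> real"
  assumes "finite I" "T \<subseteq> I"
  shows "2 ^ card I * (\<Sum>S\<in>Pow I. (f (sym_diff S T) - f S)\<^sup>2)
    = 2 * (\<Sum>A\<in>Pow I. (\<Sum>S\<in>Pow I. f S * walsh A S)\<^sup>2 * (1 - walsh A T))"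
proof -
  have "(\<Sum>S\<in>Pow I. (f (sym_diff S T) - f S)\<^sup>2)
      = (\<Sum>S\<in>Pow I. (f (sym_diff S T))\<^sup>2) + (\<Sum>S\<in>Pow I. (f S)\<^sup>2)
        - 2 * (\<Sum>S\<in>Pow I. f (sym_diff S T) * f S)"
    by (simp add: power2_diff sum.distrib sum_subtractf sum_distrib_left mult.assoc)
  also have "\<dots> = 2 * ((\<Sum>S\<in>Pow I. f S * f S) - (\<Sum>S\<in>Pow I. f (sym_diff S T) * f S))"
    using sum_shift[OF assms(2), of "\<lambda>S. (f S)\<^sup>2"] by (simp add: power2_eq_square)
  finally have expand: "(\<Sum>S\<in>Pow I. (f (sym_diff S T) - f S)\<^sup>2) = \<dots>" .
  show ?thesis unfolding expand
    using walsh_autocorrelation[OF assms(1), of "{}" f] walsh_autocorrelation[OF assms, of f]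
    by (simp add: sum_subtractf algebra_simps walsh_def)
qed

section \<open>From characters to translation-invariant inequalities in L1\<close>

text \<open>
  An absolute difference is an integral of squared differences of indicators, since the two
  thresholded values differ exactly when \<open>u\<close> lies between \<open>a\<close> and \<open>b\<close>.
\<close>

lemma integral_threshold:
  fixes a b :: real
  shows "integrable lborel (\<lambda>u. (indicator {..<a} u - indicator {..<b} u :: real)\<^sup>2)"
    and "(LINT u|lborel. (indicator {..<a} u - indicator {..<b} u)\<^sup>2) = \<bar>a - b\<bar>"
proof -
  have *: "(\<lambda>u. (indicator {..<a} u - indicator {..<b} u :: real)\<^sup>2)
      = indicator {min a b ..< max a b}"
    by (auto simp: indicator_def fun_eq_iff)
  show "integrable lborel (\<lambda>u. (indicator {..<a} u - indicator {..<b} u :: real)\<^sup>2)"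
    unfolding * by simp
  show "(LINT u|lborel. (indicator {..<a} u - indicator {..<b} u)\<^sup>2) = \<bar>a - b\<bar>"
    unfolding * by simp
qed

text \<open>
  The inequality for squared displacements follows from the one for characters by Parseval. Applied
  to the superlevel indicators \<open>S \<mapsto> 1\<^bsub>{u < f S}\<^esub>\<close> and integrated over the threshold \<open>u\<close>, it becomes
  the inequality for absolute displacements of \<open>f\<close>.
\<close>

lemma shift_inequality_abs:
  fixes f :: "'a set \<Rightarrow> real" and C :: real
  assumes I: "finite I"
    and U: "U \<in> J \<rightarrow> Pow I" and V: "V \<in> K \<rightarrow> Pow I"
    and char: "\<And>A. A \<subseteq> I \<Longrightarrow> (\<Sum>j\<in>J. 1 - walsh A (U j)) \<le> C * (\<Sum>k\<in>K. 1 - walsh A (V k))"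
  shows "(\<Sum>j\<in>J. \<Sum>S\<in>Pow I. \<bar>f (sym_diff S (U j)) - f S\<bar>)
    \<le> C * (\<Sum>k\<in>K. \<Sum>S\<in>Pow I. \<bar>f (sym_diff S (V k)) - f S\<bar>)"
proof -
  have square: "(\<Sum>j\<in>J. \<Sum>S\<in>Pow I. (g (sym_diff S (U j)) - g S)\<^sup>2)
      \<le> C * (\<Sum>k\<in>K. \<Sum>S\<in>Pow I. (g (sym_diff S (V k)) - g S)\<^sup>2)" for g :: "'a set \<Rightarrow> real"
  proof -
    define w where "w A = (\<Sum>S\<in>Pow I. g S * walsh A S)\<^sup>2" for A
    have expand: "2 ^ card I * (\<Sum>l\<in>L. \<Sum>S\<in>Pow I. (g (sym_diff S (W l)) - g S)\<^sup>2)
        = 2 * (\<Sum>A\<in>Pow I. w A * (\<Sum>l\<in>L. 1 - walsh A (W l)))"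
      if "W \<in> L \<rightarrow> Pow I" for L :: "'l set" and W
    proof -
      have "2 ^ card I * (\<Sum>l\<in>L. \<Sum>S\<in>Pow I. (g (sym_diff S (W l)) - g S)\<^sup>2)
          = (\<Sum>l\<in>L. 2 * (\<Sum>A\<in>Pow I. w A * (1 - walsh A (W l))))"
        unfolding sum_distrib_left[of _ _ L] w_def
        using that by (intro sum.cong refl sum_shift_diff_squared I) auto
      also have "\<dots> = 2 * (\<Sum>A\<in>Pow I. w A * (\<Sum>l\<in>L. 1 - walsh A (W l)))"
        unfolding sum_distrib_left by (rule sum.swap)
      finally show ?thesis .
    qed
    have "(\<Sum>A\<in>Pow I. w A * (\<Sum>j\<in>J. 1 - walsh A (U j)))
        \<le> (\<Sum>A\<in>Pow I. w A * (C * (\<Sum>k\<in>K. 1 - walsh A (V k))))"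
      by (intro sum_mono mult_left_mono char) (auto simp: w_def)
    also have "\<dots> = C * (\<Sum>A\<in>Pow I. w A * (\<Sum>k\<in>K. 1 - walsh A (V k)))"
      by (simp add: sum_distrib_left mult_ac)
    finally have "2 ^ card I * (\<Sum>j\<in>J. \<Sum>S\<in>Pow I. (g (sym_diff S (U j)) - g S)\<^sup>2)
        \<le> 2 ^ card I * (C * (\<Sum>k\<in>K. \<Sum>S\<in>Pow I. (g (sym_diff S (V k)) - g S)\<^sup>2))"
      unfolding mult.left_commute[of "2 ^ card I" C] expand[OF U] expand[OF V] by simp
    then show ?thesis by (rule mult_left_le_imp_le) simp
  qed
  define g where "g u S = (indicator {..<f S} u :: real)" for u S
  have layer: "(\<Sum>l\<in>L. \<Sum>S\<in>Pow I. \<bar>f (sym_diff S (W l)) - f S\<bar>)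
      = integral\<^sup>L lborel (\<lambda>u. \<Sum>l\<in>L. \<Sum>S\<in>Pow I. (g u (sym_diff S (W l)) - g u S)\<^sup>2)"
    and layer_integrable:
      "integrable lborel (\<lambda>u. \<Sum>l\<in>L. \<Sum>S\<in>Pow I. (g u (sym_diff S (W l)) - g u S)\<^sup>2)"
    for L :: "'l set" and W
    unfolding g_def
    by (simp_all add: Bochner_Integration.integral_sum Bochner_Integration.integrable_sum integral_threshold)
  have "integral\<^sup>L lborel (\<lambda>u. \<Sum>j\<in>J. \<Sum>S\<in>Pow I. (g u (sym_diff S (U j)) - g u S)\<^sup>2)
      \<le> integral\<^sup>L lborel (\<lambda>u. C * (\<Sum>k\<in>K. \<Sum>S\<in>Pow I. (g u (sym_diff S (V k)) - g u S)\<^sup>2))"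
    by (intro integral_mono square integrable_mult_right layer_integrable)
  then show ?thesis unfolding layer by simp
qed

text \<open>For \<open>L\<^sub>1\<close>-valued functions the real inequality is integrated pointwise.\<close>

lemma shift_inequality_L1:
  fixes f :: "'a set \<Rightarrow> real \<Rightarrow> real" and C :: real
  assumes I: "finite I" and f: "\<And>S. S \<subseteq> I \<Longrightarrow> f S \<in> L1_space"
    and U: "U \<in> J \<rightarrow> Pow I" and V: "V \<in> K \<rightarrow> Pow I"
    and char: "\<And>A. A \<subseteq> I \<Longrightarrow> (\<Sum>j\<in>J. 1 - walsh A (U j)) \<le> C * (\<Sum>k\<in>K. 1 - walsh A (V k))"
  shows "(\<Sum>j\<in>J. \<Sum>S\<in>Pow I. L1_norm (\<lambda>t. f (sym_diff S (U j)) t - f S t))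
    \<le> C * (\<Sum>k\<in>K. \<Sum>S\<in>Pow I. L1_norm (\<lambda>t. f (sym_diff S (V k)) t - f S t))"
proof -
  let ?M = "lebesgue_on {0<..<1::real}"
  have diff: "integrable ?M (\<lambda>t. \<bar>f (sym_diff S (W l)) t - f S t\<bar>)"
    if "W \<in> L \<rightarrow> Pow I" "l \<in> L" "S \<in> Pow I" for L :: "'l set" and W l S
  proof -
    have "sym_diff S (W l) \<subseteq> I" using that by (auto simp: Pi_iff)
    with f[OF this] f[of S] that(3) show ?thesis by (simp add: L1_space_def)
  qed
  have swap: "(\<Sum>l\<in>L. \<Sum>S\<in>Pow I. L1_norm (\<lambda>t. f (sym_diff S (W l)) t - f S t))
      = (integral\<^sup>L ?M (\<lambda>t. \<Sum>l\<in>L. \<Sum>S\<in>Pow I. \<bar>f (sym_diff S (W l)) t - f S t\<bar>))"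
    if "W \<in> L \<rightarrow> Pow I" for L :: "'l set" and W
  proof -
    have "(integral\<^sup>L ?M (\<lambda>t. \<Sum>l\<in>L. \<Sum>S\<in>Pow I. \<bar>f (sym_diff S (W l)) t - f S t\<bar>))
        = (\<Sum>l\<in>L. integral\<^sup>L ?M (\<lambda>t. \<Sum>S\<in>Pow I. \<bar>f (sym_diff S (W l)) t - f S t\<bar>))"
      by (intro Bochner_Integration.integral_sum Bochner_Integration.integrable_sum diff[of W L] that)
    also have "\<dots> = (\<Sum>l\<in>L. \<Sum>S\<in>Pow I. L1_norm (\<lambda>t. f (sym_diff S (W l)) t - f S t))"
      unfolding L1_norm_def by (intro sum.cong refl Bochner_Integration.integral_sum diff[of W L] that)
    finally show ?thesis by simp
  qed
  have "(integral\<^sup>L ?M (\<lambda>t. \<Sum>j\<in>J. \<Sum>S\<in>Pow I. \<bar>f (sym_diff S (U j)) t - f S t\<bar>))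
      \<le> (integral\<^sup>L ?M (\<lambda>t. C * (\<Sum>k\<in>K. \<Sum>S\<in>Pow I. \<bar>f (sym_diff S (V k)) t - f S t\<bar>)))"
    by (intro integral_mono Bochner_Integration.integrable_sum integrable_mult_right
          diff[OF U] diff[OF V] shift_inequality_abs I U V char)
  then show ?thesis by (simp add: swap[OF U] swap[OF V])
qed

section \<open>Row flips against one flip per row\<close>

definition row_flip :: "nat \<Rightarrow> nat \<Rightarrow> (nat \<times> nat) set" where
  "row_flip n j = {j} \<times> {1..n}"

text \<open>
  The map \<open>\<kappa>\<close> takes values in \<open>{0..n}\<close>, and the value \<open>0\<close> leaves the row unchanged. With this extra
  outcome the average of a character over one row is \<open>1 - 2a/(n + 1)\<close> with \<open>a \<le> n\<close>, which stays
  away from \<open>-1\<close>. Without it a full row with \<open>a = n\<close> odd would give \<open>-1\<close>, and two such rows would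
  hide each other in the product.
\<close>

definition transversal_flip :: "nat \<Rightarrow> (nat \<Rightarrow> nat) \<Rightarrow> (nat \<times> nat) set" where
  "transversal_flip n \<kappa> = {(j, \<kappa> j) | j. j \<in> {1..n}} \<inter> {1..n} \<times> {1..n}"

text \<open>
  Bernoulli's inequality for \<open>(1 + q)\<^sup>m\<close> gives \<open>(1 - q)\<^sup>m \<le> 1 / (1 + m q)\<close>, hence
  \<open>1 - (1 - q)\<^sup>m \<ge> m q / (1 + m q)\<close>, and the denominator is at most 3.
\<close>

lemma one_minus_power_ge:
  fixes q :: real
  assumes "0 \<le> q" "q \<le> 1" "m * q \<le> 2"
  shows "m * q \<le> 3 * (1 - (1 - q) ^ m)"
proof -
  have "(1 - q) ^ m * (1 + m * q) \<le> (1 - q) ^ m * (1 + q) ^ m"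
    using Bernoulli_inequality[of q m] assms by (intro mult_left_mono) auto
  also have "\<dots> = (1 - q\<^sup>2) ^ m"
    by (simp add: power_mult_distrib[symmetric] algebra_simps power2_eq_square)
  also have "\<dots> \<le> 1"
    using assms by (intro power_le_one) (auto simp: abs_square_le_1 power_le_one)
  finally have "(1 - q) ^ m * (1 + m * q) \<le> 1" .
  moreover have "(m * q) * (1 + m * q) \<le> (m * q) * 3"
    using assms by (intro mult_left_mono) auto
  ultimately have "(m * q) * (1 + m * q) \<le> 3 * (1 - (1 - q) ^ m) * (1 + m * q)"
    by (simp add: algebra_simps)
  moreover have "0 < 1 + m * q" using assms by (simp add: add_pos_nonneg)
  ultimately show ?thesis by (rule mult_right_le_imp_le)
qed

lemma prod_le_power_card:
  fixes h :: "'a \<Rightarrow> real"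
  assumes "finite J" "M \<subseteq> J" "\<And>j. j \<in> J \<Longrightarrow> \<bar>h j\<bar> \<le> 1" "\<And>j. j \<in> M \<Longrightarrow> \<bar>h j\<bar> \<le> r"
  shows "(\<Prod>j\<in>J. h j) \<le> r ^ card M"
proof -
  have "(\<Prod>j\<in>J. h j) \<le> (\<Prod>j\<in>J. \<bar>h j\<bar>)" by (simp add: abs_prod[symmetric])
  also have "\<dots> \<le> (\<Prod>j\<in>J. if j \<in> M then r else 1)"
    using assms by (intro prod_mono) auto
  also have "\<dots> = r ^ card M"
    using assms by (simp add: prod.If_cases Int_absorb1)
  finally show ?thesis .
qed

text \<open>
  The rows are flipped independently, so the sum over all \<open>\<kappa>\<close> factors. In row \<open>j\<close>, the character is
  \<open>-1\<close> at the columns of \<open>A\<close> in that row and \<open>1\<close> at the remaining values of \<open>\<kappa> j\<close>.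
\<close>

lemma sum_walsh_transversal_flip:
  assumes A: "A \<subseteq> {1..n} \<times> {1..n}"
  shows "(\<Sum>\<kappa>\<in>{1..n} \<rightarrow>\<^sub>E {0..n}. walsh A (transversal_flip n \<kappa>))
    = (\<Prod>j=1..n. real (n + 1) - 2 * real (card (A `` {j})))"
proof -
  have "(\<Sum>\<kappa>\<in>{1..n} \<rightarrow>\<^sub>E {0..n}. walsh A (transversal_flip n \<kappa>))
      = (\<Sum>\<kappa>\<in>{1..n} \<rightarrow>\<^sub>E {0..n}. \<Prod>j=1..n. if (j, \<kappa> j) \<in> A then -1 else 1)"
  proof (rule sum.cong[OF refl])
    fix \<kappa> :: "nat \<Rightarrow> nat"
    have "A \<inter> transversal_flip n \<kappa> = (\<lambda>j. (j, \<kappa> j)) ` {j \<in> {1..n}. (j, \<kappa> j) \<in> A}"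
      using A unfolding transversal_flip_def by auto
    then have "card (A \<inter> transversal_flip n \<kappa>) = card {j \<in> {1..n}. (j, \<kappa> j) \<in> A}"
      by (simp add: card_image inj_on_def)
    then show "walsh A (transversal_flip n \<kappa>) = (\<Prod>j=1..n. if (j, \<kappa> j) \<in> A then -1 else 1)"
      unfolding walsh_def by (simp add: prod.If_cases Int_def)
  qed
  also have "\<dots> = (\<Prod>j=1..n. \<Sum>k=0..n. if (j, k) \<in> A then -1 else 1)"
    by (subst prod_sum_PiE) auto
  also have "\<dots> = (\<Prod>j=1..n. real (n + 1) - 2 * real (card (A `` {j})))"
  proof (rule prod.cong[OF refl])
    fix j
    have "(\<Sum>k=0..n. if (j, k) \<in> A then -1 else 1 :: real)
        = (\<Sum>k=0..n. 1 - 2 * indicator (A `` {j}) k)"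
      by (intro sum.cong) auto
    also have "\<dots> = real (n + 1) - 2 * real (card ({0..n} \<inter> A `` {j}))"
      unfolding sum_subtractf sum_distrib_left[symmetric]
      by (simp only: indicator_def sum_of_bool_eq finite_atLeastAtMost Collect_mem_eq) simp
    also have "{0..n} \<inter> A `` {j} = A `` {j}" using A by auto
    finally show "(\<Sum>k=0..n. if (j, k) \<in> A then -1 else 1 :: real)
        = real (n + 1) - 2 * real (card (A `` {j}))" .
  qed
  finally show ?thesis .
qed

text \<open>
  This is the whole combinatorial content of the Kwapien--Schuett type inequality: only the \<open>m\<close>
  rows in which \<open>A\<close> has odd size are visible to row flips, and those rows force the average of
  the character over one-flip-per-row steps down to \<open>(1 - q)\<^sup>m\<close> with \<open>q = 2/(n + 1)\<close>. The divisor
  \<open>(n + 1)\<^sup>n\<close> is the number of maps \<open>\<kappa>\<close>.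
\<close>

lemma flips_walsh_inequality:
  assumes A: "A \<subseteq> {1..n} \<times> {1..n}" and n: "n \<ge> 1"
  shows "(\<Sum>j=1..n. 1 - walsh A (row_flip n j))
    \<le> 6 * real n / (real n + 1) ^ n * (\<Sum>\<kappa>\<in>{1..n} \<rightarrow>\<^sub>E {0..n}. 1 - walsh A (transversal_flip n \<kappa>))"
proof -
  define a where "a j = card (A `` {j})" for j
  define M where "M = {j \<in> {1..n}. odd (a j)}"
  define q where "q = 2 / real (n + 1)"
  define P where "P = (\<Prod>j=1..n. 1 - q * a j)"
  have a_le: "a j \<le> n" for j
    using card_mono[of "{1..n}" "A `` {j}"] A unfolding a_def by auto
  have "walsh A (row_flip n j) = (-1) ^ a j" for j
  proof -
    have "A \<inter> row_flip n j = Pair j ` (A `` {j})"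
      using A unfolding row_flip_def by auto
    then show ?thesis unfolding walsh_def a_def by (simp add: card_image inj_on_def)
  qed
  then have "(\<Sum>j=1..n. 1 - walsh A (row_flip n j)) = (\<Sum>j=1..n. if j \<in> M then 2 else 0)"
    by (intro sum.cong) (auto simp: M_def)
  also have "\<dots> = 2 * card M"
    by (simp add: sum.If_cases M_def Int_def)
  finally have rows: "(\<Sum>j=1..n. 1 - walsh A (row_flip n j)) = 2 * card M" .
  have "M \<subseteq> {1..n}" by (auto simp: M_def)
  then have M_le: "card M \<le> n"
    using card_mono[of "{1..n}" M] by simp
  have q: "0 \<le> q" "q \<le> 1" "1 \<le> real n * q"
    using n by (auto simp: q_def divide_le_eq le_divide_eq)
  have q_mult: "q * (real n + 1) = 2" unfolding q_def by (simp add: field_simps)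
  have qa: "q * real (a j) + q \<le> 2" for j
    using mult_left_mono[of "real (a j) + 1" "real n + 1" q] a_le[of j] q q_mult
    by (simp add: distrib_left)
  have prod_le: "P \<le> (1 - q) ^ card M"
    unfolding P_def
  proof (rule prod_le_power_card)
    show "\<bar>1 - q * real (a j)\<bar> \<le> 1" for j
      using qa[of j] q mult_nonneg_nonneg[of q "real (a j)"] by linarith
    (* An odd number is at least 1, which bounds the factor above; a j <= n bounds it below. *)
    fix j assume "j \<in> M"
    then have "1 \<le> real (a j)" by (cases "a j") (auto simp: M_def)
    then have "q \<le> q * real (a j)" using mult_left_mono[of 1 "real (a j)" q] q by simp
    then show "\<bar>1 - q * real (a j)\<bar> \<le> 1 - q"
      using qa[of j] by linarith
  qed (use \<open>M \<subseteq> {1..n}\<close> in auto)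
  have "card M * q \<le> 3 * (1 - (1 - q) ^ card M)"
  proof (rule one_minus_power_ge)
    show "card M * q \<le> 2"
      using mult_right_mono[of "real (card M)" "real n + 1" q] M_le q q_mult by (simp add: mult.commute)
  qed (use q in auto)
  also have "\<dots> \<le> 3 * (1 - P)"
    using prod_le by simp
  finally have "n * (card M * q) \<le> n * (3 * (1 - P))"
    by (rule mult_left_mono) simp
  moreover have "card M \<le> n * (card M * q)"
    using mult_left_mono[OF q(3), of "real (card M)"] by (simp add: mult_ac)
  ultimately have key: "2 * card M \<le> 6 * n * (1 - P)"
    by (simp add: algebra_simps)
  have "(\<Sum>\<kappa>\<in>{1..n} \<rightarrow>\<^sub>E {0..n}. 1 - walsh A (transversal_flip n \<kappa>))
      = (n + 1) ^ n - (\<Prod>j=1..n. real (n + 1) - 2 * a j)"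
    unfolding sum_subtractf sum_walsh_transversal_flip[OF A] a_def by (simp add: card_PiE)
  also have "(\<Prod>j=1..n. real (n + 1) - 2 * a j) = (\<Prod>j=1..n. real (n + 1) * (1 - q * a j))"
    by (intro prod.cong) (auto simp: q_def field_simps)
  also have "\<dots> = (n + 1) ^ n * P"
    by (simp add: prod.distrib P_def)
  finally have steps: "(\<Sum>\<kappa>\<in>{1..n} \<rightarrow>\<^sub>E {0..n}. 1 - walsh A (transversal_flip n \<kappa>))
      = (real n + 1) ^ n * (1 - P)"
    by (simp add: algebra_simps)
  have "(real n + 1) ^ n > 0" by (intro zero_less_power) simp
  then show ?thesis using key unfolding rows steps by simp
qed

section \<open>The lower bound\<close>

definition bits_of :: "nat \<Rightarrow> (nat \<times> nat) set \<Rightarrow> nat \<Rightarrow> nat \<Rightarrow> bit" where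
  "bits_of n S = (\<lambda>j\<in>{1..n}. \<lambda>k\<in>{1..n}. of_bool ((j, k) \<in> S))"

lemma bits_of_in_mspace: "bits_of n S \<in> mspace (l2_power n (F2_cube n))"
  by (auto simp: mspace_l2_power mspace_F2_cube bits_of_def)

lemma mdist_bits_of_sym_diff:
  assumes T: "T \<subseteq> {1..n} \<times> {1..n}"
  shows "mdist (l2_power n (F2_cube n)) (bits_of n (sym_diff S T)) (bits_of n S)
    = sqrt (\<Sum>j=1..n. (card (T `` {j}))\<^sup>2)"
proof -
  have "mdist (F2_cube n) (bits_of n (sym_diff S T) j) (bits_of n S j) = card (T `` {j})"
    if "j \<in> {1..n}" for j
  proof -
    have "mdist (F2_cube n) (bits_of n (sym_diff S T) j) (bits_of n S j)
        = (\<Sum>k=1..n. indicator (T `` {j}) k)"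
      unfolding mdist_F2_cube using that
      by (intro sum.cong) (auto simp: bits_of_def)
    also have "\<dots> = card ({1..n} \<inter> T `` {j})"
      by (simp only: indicator_def sum_of_bool_eq finite_atLeastAtMost Collect_mem_eq)
    also have "{1..n} \<inter> T `` {j} = T `` {j}" using T by auto
    finally show ?thesis .
  qed
  then show ?thesis by (simp add: mdist_l2_power)
qed

lemma mdist_row_flip:
  assumes "j \<in> {1..n}"
  shows "mdist (l2_power n (F2_cube n)) (bits_of n (sym_diff S (row_flip n j))) (bits_of n S) = n"
proof -
  have "row_flip n j `` {i} = (if i = j then {1..n} else {})" for i
    by (auto simp: row_flip_def)
  then have "(\<Sum>i=1..n. (card (row_flip n j `` {i}))\<^sup>2) = (\<Sum>i=1..n. if i = j then n\<^sup>2 else 0)"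
    by (intro sum.cong) auto
  also have "\<dots> = n\<^sup>2" using assms by simp
  finally show ?thesis
    using assms by (subst mdist_bits_of_sym_diff) (auto simp: row_flip_def real_sqrt_unique)
qed

lemma mdist_transversal_flip:
  "mdist (l2_power n (F2_cube n)) (bits_of n (sym_diff S (transversal_flip n \<kappa>))) (bits_of n S)
    \<le> sqrt n"
proof -
  have "card (transversal_flip n \<kappa> `` {j}) \<le> 1" for j
    using card_mono[of "{\<kappa> j}" "transversal_flip n \<kappa> `` {j}"] by (auto simp: transversal_flip_def)
  then have "(\<Sum>j=1..n. (card (transversal_flip n \<kappa> `` {j}))\<^sup>2) \<le> (\<Sum>j=1..n. 1)"
    by (intro sum_mono power_le_one) simp_all
  then show ?thesis
    by (subst mdist_bits_of_sym_diff) (auto simp: transversal_flip_def simp del: of_nat_sum)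
qed

text \<open>
  The two averages in the inequality are compared with \<open>s n\<close> from below and \<open>D s \<surd>n\<close> from above,
  and the normalising factors cancel.
\<close>

lemma distortion_lower_bound:
  assumes n: "n \<ge> 1" and emb: "embeds_in_L1_with_distortion (l2_power n (F2_cube n)) D" and D: "1 \<le> D"
  shows "sqrt n / 6 \<le> D"
proof -
  let ?X = "l2_power n (F2_cube n)"
  let ?I = "{1..n} \<times> {1..n}" and ?K = "{1..n} \<rightarrow>\<^sub>E {0..n}"
  obtain s f where s: "s > 0" and f: "f \<in> mspace ?X \<rightarrow> L1_space"
    and lower: "\<And>x y. x \<in> mspace ?X \<Longrightarrow> y \<in> mspace ?X \<Longrightarrow>
        s * mdist ?X x y \<le> L1_norm (\<lambda>t. f x t - f y t)"
    and upper: "\<And>x y. x \<in> mspace ?X \<Longrightarrow> y \<in> mspace ?X \<Longrightarrow>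
        L1_norm (\<lambda>t. f x t - f y t) \<le> D * s * mdist ?X x y"
    using emb unfolding embeds_in_L1_with_distortion_def by blast
  define F where "F S = f (bits_of n S)" for S
  define N :: real where "N = 2 ^ card ?I"
  have N: "N > 0" by (simp add: N_def)
  have "n * N * (s * n) = (\<Sum>j=1..n. \<Sum>S\<in>Pow ?I. s * n)"
    by (simp add: N_def card_Pow)
  also have "\<dots> \<le> (\<Sum>j=1..n. \<Sum>S\<in>Pow ?I. L1_norm (\<lambda>t. F (sym_diff S (row_flip n j)) t - F S t))"
    unfolding F_def
  proof (intro sum_mono)
    fix j S assume "j \<in> {1..n}"
    then show "s * n \<le> L1_norm (\<lambda>t. f (bits_of n (sym_diff S (row_flip n j))) t - f (bits_of n S) t)"
      using lower[OF bits_of_in_mspace[of n "sym_diff S (row_flip n j)"] bits_of_in_mspace[of n S]]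
      by (simp add: mdist_row_flip)
  qed
  also have "\<dots> \<le> 6 * real n / (real n + 1) ^ n
      * (\<Sum>\<kappa>\<in>?K. \<Sum>S\<in>Pow ?I. L1_norm (\<lambda>t. F (sym_diff S (transversal_flip n \<kappa>)) t - F S t))"
  proof (rule shift_inequality_L1)
    show "F S \<in> L1_space" for S
      using f bits_of_in_mspace[of n S] by (auto simp: F_def)
    show "(\<Sum>j=1..n. 1 - walsh A (row_flip n j))
        \<le> 6 * real n / (real n + 1) ^ n * (\<Sum>\<kappa>\<in>?K. 1 - walsh A (transversal_flip n \<kappa>))" if "A \<subseteq> ?I" for A
      by (rule flips_walsh_inequality[OF that n])
  qed (auto simp: row_flip_def transversal_flip_def)
  also have "\<dots> \<le> 6 * real n / (real n + 1) ^ n * (\<Sum>\<kappa>\<in>?K. \<Sum>S\<in>Pow ?I. D * s * sqrt n)"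
    unfolding F_def
  proof (intro mult_left_mono sum_mono)
    fix \<kappa> S
    show "L1_norm (\<lambda>t. f (bits_of n (sym_diff S (transversal_flip n \<kappa>))) t - f (bits_of n S) t)
        \<le> D * s * sqrt n"
      using D s by (intro order_trans[OF upper[OF bits_of_in_mspace bits_of_in_mspace]]
          mult_left_mono mdist_transversal_flip) auto
  qed auto
  also have "\<dots> = 6 * n * N * (D * s * sqrt n)"
    by (simp add: N_def card_Pow card_PiE field_simps)
  finally have "(n * N * s) * n \<le> (n * N * s) * (6 * D * sqrt n)"
    by (simp add: mult_ac)
  moreover have "n * N * s > 0" using n N s by simp
  ultimately have "real n \<le> 6 * D * sqrt n" by (rule mult_left_le_imp_le)
  then have "sqrt n * sqrt n \<le> 6 * D * sqrt n" by simp
  then have "sqrt n \<le> 6 * D" using n by (subst (asm) mult_le_cancel_right) auto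
  then show ?thesis by simp
qed

section \<open>The upper bound\<close>

text \<open>
  The functions \<open>bump i\<close> are normalised indicators of disjoint intervals in \<open>(0,1)\<close>, so they span an
  isometric copy of \<open>\<ell>\<^sub>1\<close> in \<open>L\<^sub>1\<close>. Any disjoint intervals would do; these do not depend on \<open>n\<close>.
\<close>

definition bump_interval :: "nat \<Rightarrow> real set" where
  "bump_interval i = {1 / real (i + 2) <..< 1 / real (i + 1)}"

definition bump :: "nat \<Rightarrow> real \<Rightarrow> real" where
  "bump i t = indicator (bump_interval i) t / measure lebesgue (bump_interval i)"

lemma bump_interval_disjoint:
  assumes "i \<noteq> j"
  shows "bump_interval i \<inter> bump_interval j = {}"
proof -
  have *: "bump_interval i \<inter> bump_interval j = {}" if "i < j" for i j
  proof -
    have "1 / real (j + 1) \<le> 1 / real (i + 2)" using that by (intro divide_left_mono) auto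
    then show ?thesis by (auto simp: bump_interval_def disjoint_iff simp del: of_nat_add)
  qed
  show ?thesis using assms *[of i j] *[of j i] by (cases i j rule: linorder_cases) auto
qed

lemma bump_integral:
  shows "integrable (lebesgue_on {0<..<1}) (bump i)"
    and "(LINT t|lebesgue_on {0<..<1}. bump i t) = 1"
proof -
  have sub: "bump_interval i \<subseteq> {0<..<1}"
  proof
    fix t assume "t \<in> bump_interval i"
    then have "1 / real (i + 2) < t" "t < 1 / real (i + 1)" by (simp_all add: bump_interval_def)
    moreover have "0 < 1 / real (i + 2)" "1 / real (i + 1) \<le> 1" by simp_all
    ultimately show "t \<in> {0<..<1}" unfolding greaterThanLessThan_iff by linarith
  qed
  have meas: "bump_interval i \<in> lmeasurable" by (simp add: bump_interval_def)
  have pos: "measure lebesgue (bump_interval i) > 0"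
  proof -
    have less: "1 / real (i + 2) < 1 / real (i + 1)" by (rule frac_less2) auto
    then show ?thesis
      unfolding bump_interval_def by (simp add: measure_lborel_Ioo[OF less_imp_le] del: of_nat_add)
  qed
  have eq: "indicator {0<..<1} t *\<^sub>R bump i t = bump i t" for t :: real
    using sub by (auto simp: bump_def indicator_def)
  have *: "has_bochner_integral lebesgue (bump i) 1"
  proof -
    have "has_bochner_integral lebesgue (indicator (bump_interval i)) (measure lebesgue (bump_interval i))"
      using meas by (intro has_bochner_integral_real_indicator) (auto simp: fmeasurable_def)
    from has_bochner_integral_divide_zero[OF this, of "measure lebesgue (bump_interval i)"]
    show ?thesis using pos by (simp add: bump_def[abs_def])
  qed
  then have "has_bochner_integral (lebesgue_on {0<..<1}) (bump i) 1"
    by (subst has_bochner_integral_restrict_space) (simp_all add: eq del: real_scaleR_def)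
  then show "integrable (lebesgue_on {0<..<1}) (bump i)"
    and "(LINT t|lebesgue_on {0<..<1}. bump i t) = 1"
    by (auto simp: has_bochner_integral_iff)
qed

lemma L1_norm_sum_bump:
  assumes "finite I"
  shows "L1_norm (\<lambda>t. \<Sum>i\<in>I. c i * bump i t) = (\<Sum>i\<in>I. \<bar>c i\<bar>)"
proof -
  have nonneg: "0 \<le> bump i t" for i t by (simp add: bump_def)
  have "\<bar>\<Sum>i\<in>I. c i * bump i t\<bar> = (\<Sum>i\<in>I. \<bar>c i\<bar> * bump i t)" for t
  proof (cases "\<exists>i\<in>I. t \<in> bump_interval i")
    case True
    then obtain k where k: "k \<in> I" "t \<in> bump_interval k" by blast
    have "bump i t = 0" if "i \<noteq> k" for i
      using bump_interval_disjoint[OF that] k(2) by (auto simp: bump_def disjoint_iff indicator_def)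
    then have "(\<Sum>i\<in>I. d i * bump i t) = d k * bump k t" for d
      using assms k(1) by (subst sum.remove[of _ k]) (auto intro!: sum.neutral)
    then show ?thesis using nonneg by (simp add: abs_mult)
  next
    case False
    then show ?thesis by (simp add: bump_def)
  qed
  then show ?thesis unfolding L1_norm_def
    by (simp add: Bochner_Integration.integral_sum bump_integral)
qed

text \<open>
  Matrices are sent to the span of the bumps, one bump for each entry. The \<open>L\<^sub>1\<close> distance is then the
  \<open>\<ell>\<^sub>1\<close> sum of the Hamming distances of the rows, which lies between their \<open>\<ell>\<^sub>2\<close> sum and, by
  Cauchy--Schwarz, \<open>\<surd>n\<close> times it.
\<close>

lemma sqrt_distortion_embedding:
  "embeds_in_L1_with_distortion (l2_power n (F2_cube n)) (sqrt n)"
proof -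
  let ?X = "l2_power n (F2_cube n)" and ?I = "{1..n} \<times> {1..n}"
  define f :: "(nat \<Rightarrow> nat \<Rightarrow> bit) \<Rightarrow> real \<Rightarrow> real"
    where "f x t = (\<Sum>(j, k)\<in>?I. of_bit (x j k) * bump (prod_encode (j, k)) t)" for x t
  have f: "f x \<in> L1_space" for x
    unfolding L1_space_def f_def case_prod_unfold
    by (auto intro!: Bochner_Integration.integrable_sum integrable_mult_right bump_integral simp: eta_contract_eq)
  have norm: "L1_norm (\<lambda>t. f x t - f y t) = (\<Sum>j=1..n. mdist (F2_cube n) (x j) (y j))" for x y
  proof -
    define c where "c i = (case prod_decode i of (j, k) \<Rightarrow> (of_bit (x j k) - of_bit (y j k) :: real))" for i
    have inj: "inj_on prod_encode ?I" by (simp add: inj_prod_encode)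
    have "f x t - f y t = (\<Sum>i\<in>prod_encode ` ?I. c i * bump i t)" for t
      unfolding f_def sum.reindex[OF inj] sum_subtractf[symmetric]
      by (intro sum.cong) (auto simp: c_def algebra_simps)
    then have "L1_norm (\<lambda>t. f x t - f y t) = (\<Sum>i\<in>prod_encode ` ?I. \<bar>c i\<bar>)"
      by (simp add: L1_norm_sum_bump)
    also have "\<dots> = (\<Sum>(j, k)\<in>?I. \<bar>of_bit (x j k) - of_bit (y j k)\<bar>)"
      unfolding sum.reindex[OF inj] by (intro sum.cong) (auto simp: c_def)
    finally show ?thesis by (simp add: sum.cartesian_product mdist_F2_cube)
  qed
  have lower: "mdist ?X x y \<le> (\<Sum>j=1..n. mdist (F2_cube n) (x j) (y j))" for x y
    using L2_set_le_sum[of "{1..n}" "\<lambda>j. mdist (F2_cube n) (x j) (y j)"]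
    by (simp add: mdist_l2_power L2_set_def)
  have upper: "(\<Sum>j=1..n. mdist (F2_cube n) (x j) (y j)) \<le> sqrt n * mdist ?X x y" for x y
    using sum_squared_le_sum_of_squares[of "\<lambda>j. mdist (F2_cube n) (x j) (y j)" "{1..n}"]
    unfolding mdist_l2_power real_sqrt_mult[symmetric]
    by (intro real_le_rsqrt) (simp add: mult.commute)
  show ?thesis
    unfolding embeds_in_L1_with_distortion_def
  proof (intro exI[of _ 1] conjI bexI[of _ f] ballI)
    show "f \<in> mspace ?X \<rightarrow> L1_space" using f by blast
  qed (use lower upper in \<open>simp_all add: norm\<close>)
qed

theorem theorem1p1:
  shows "\<exists>c C :: real. 0 < c \<and> 0 < C \<and>
    (\<forall>n :: nat. n \<ge> 1 \<longrightarrow>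
       ereal (c * sqrt (real n)) \<le> c1 (l2_power n (F2_cube n)) \<and>
       c1 (l2_power n (F2_cube n)) \<le> ereal (C * sqrt (real n)))"
proof (rule exI[of _ "1/6"], rule exI[of _ 1], intro conjI allI impI)
  fix n :: nat assume n: "n \<ge> 1"
  show "ereal (1/6 * sqrt n) \<le> c1 (l2_power n (F2_cube n))"
    unfolding c1_def by (rule Inf_greatest) (auto dest: distortion_lower_bound[OF n])
  show "c1 (l2_power n (F2_cube n)) \<le> ereal (1 * sqrt n)"
    unfolding c1_def using n sqrt_distortion_embedding[of n] by (intro Inf_lower) auto
qed auto

end
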